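(* Let $q\ge 2$ and $d\ge 1$ be integers and let $\mathbb{T}_{q+1}$ be the infinite $(q+1)$-regular tree with graph distance $\operatorname{dist}$. Let $\{\mu_u^n\}_{u\in V(\mathbb{T}_{q+1}),\,n\in\mathbb{Z}_{\ge 0}}$ be a family of finitely supported probability measures on the vertices such that $\mu_u^n(v)=\mu_{u'}^n(v')$ whenever $\operatorname{dist}(u,v)=\operatorname{dist}(u',v')$, and write $g(\ell,n):=\mu_u^n(v)$ for any $u,v$ with $\operatorname{dist}(u,v)=\ell$. Let $X,Y$ be vertices with $\operatorname{dist}(X,Y)=d$, and put $\delta=\lfloor d/2\rfloor$, $\delta'=\lceil d/2\rceil$. Then $W=W_1(\mu_X^n,\mu_Y^n)$ satisfies, for every $n\ge 0$, \begin{align*} W &= \left\{ 2q + 2 - 2q^{1-\delta'} - 2q^{-\delta} \right\} \cdot [y^n] G_1(q,y) \\ &\quad + \left\{ d + \frac{d}{q} - \frac{4}{q-1} + 2\delta' q^{-\delta'} + \frac{2}{q-1} q^{-\delta'} + 2\delta q^{-1-\delta} + \frac{2}{q-1} q^{-\delta} \right\} \cdot [y^n] G(q,y) \\ &\quad - \frac{d}{q} \cdot [y^n] \gamma_0(y) \\ &\quad + \sum_{i=0}^{\delta} \left( \frac{4}{q-1} + \left( 2i - 2\delta' - \frac{2}{q-1} \right) q^{i-\delta'} + \left( \frac{2i}{q} - \frac{2\delta}{q} - \frac{2}{q-1} \right) q^{i-\delta} \right) \cdot [y^n] \gamma_i(y). \end{align*}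
   Context: $W_1(\mu,\nu)$ is the $1$-Wasserstein (transportation) distance between finitely supported probability measures on the vertex set: the minimum over couplings $\pi\ge 0$ on $V\times V$ with marginals $\mu$ and $\nu$ of $\sum_{v,w}\operatorname{dist}(v,w)\pi(v,w)$. Generating functions: $G(x,y)=\sum_{\ell,n\ge 0} g(\ell,n)x^\ell y^n$, $G_1(x,y)=\partial G/\partial x$, $\gamma_i(y)=\sum_{n\ge0} g(i,n)y^n$. $[y^n]F(y)$ denotes the coefficient of $y^n$; in particular $[y^n]G(q,y)=\sum_{\ell\ge0} g(\ell,n)q^\ell$ and $[y^n]G_1(q,y)=\sum_{\ell\ge1}\ell\, g(\ell,n)q^{\ell-1}$ (finite sums by finite support). *)

theory Defs
  imports "HOL-Probability.Probability" "HOL-Analysis.FPS_Convergence"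
begin

(* An undirected edge between u and v is the pair of arcs (u,v), (v,u); a cycle therefore
   needs at least three distinct vertices, so that a single edge is not a cycle. *)

definition simple_graph :: "'v set \<Rightarrow> ('v \<times> 'v) set \<Rightarrow> bool" where
  "simple_graph V E \<longleftrightarrow> E \<subseteq> V \<times> V \<and> sym E \<and> irrefl E"

definition graph_cycle :: "('v \<times> 'v) set \<Rightarrow> 'v list \<Rightarrow> bool" where
  "graph_cycle E p \<longleftrightarrow>
     length p \<ge> 3 \<and> distinct p \<and> successively (\<lambda>u v. (u, v) \<in> E) p \<and> (last p, hd p) \<in> E"

definition graph_tree :: "'v set \<Rightarrow> ('v \<times> 'v) set \<Rightarrow> bool" where
  "graph_tree V E \<longleftrightarrow>
     simple_graph V E \<and> V \<noteq> {} \<and> (\<forall>u\<in>V. \<forall>v\<in>V. (u, v) \<in> E\<^sup>*) \<and> (\<nexists>p. graph_cycle E p)"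

(* For k \<ge> 2 such a tree is automatically infinite, and it is unique up to isomorphism. *)
definition regular_tree :: "nat \<Rightarrow> 'v set \<Rightarrow> ('v \<times> 'v) set \<Rightarrow> bool" where
  "regular_tree k V E \<longleftrightarrow>
     graph_tree V E \<and> (\<forall>u\<in>V. finite (E `` {u}) \<and> card (E `` {u}) = k)"

definition graph_dist :: "('v \<times> 'v) set \<Rightarrow> 'v \<Rightarrow> 'v \<Rightarrow> nat" where
  "graph_dist E u v = (LEAST n. (u, v) \<in> E ^^ n)"

definition couplings :: "'v pmf \<Rightarrow> 'v pmf \<Rightarrow> ('v \<times> 'v) pmf set" where
  "couplings \<mu> \<nu> = {\<pi>. map_pmf fst \<pi> = \<mu> \<and> map_pmf snd \<pi> = \<nu>}"

definition transport_cost :: "('v \<times> 'v) set \<Rightarrow> ('v \<times> 'v) pmf \<Rightarrow> real" where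
  "transport_cost E \<pi> = measure_pmf.expectation \<pi> (\<lambda>(v, w). real (graph_dist E v w))"

(* LEAST on the reals denotes an attained minimum, not merely an infimum. *)
definition W1 :: "('v \<times> 'v) set \<Rightarrow> 'v pmf \<Rightarrow> 'v pmf \<Rightarrow> real" where
  "W1 E \<mu> \<nu> = (LEAST c. \<exists>\<pi>\<in>couplings \<mu> \<nu>. c = transport_cost E \<pi>)"

(* A series F(x,y) is represented as a power series in y whose coefficients are power series in x. *)

definition gen_G :: "(nat \<Rightarrow> nat \<Rightarrow> real) \<Rightarrow> real fps fps" where
  "gen_G g = Abs_fps (\<lambda>n. Abs_fps (\<lambda>l. g l n))"

definition deriv_x :: "real fps fps \<Rightarrow> real fps fps" where
  "deriv_x F = Abs_fps (\<lambda>n. fps_deriv (fps_nth F n))"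

definition eval_x :: "real fps fps \<Rightarrow> real \<Rightarrow> real fps" where
  "eval_x F x = Abs_fps (\<lambda>n. eval_fps (fps_nth F n) x)"

definition gen_G1 :: "(nat \<Rightarrow> nat \<Rightarrow> real) \<Rightarrow> real fps fps" where
  "gen_G1 g = deriv_x (gen_G g)"

definition gen_gamma :: "(nat \<Rightarrow> nat \<Rightarrow> real) \<Rightarrow> nat \<Rightarrow> real fps" where
  "gen_gamma g i = Abs_fps (\<lambda>n. g i n)"

end

theory Submission
  imports Defs
begin

text \<open>
  An explicit flow and a potential certify each other's optimality. Write \<open>S a\<close> for the mass that
  \<open>\<mu> u\<close> puts on the branch behind a vertex at distance \<open>a\<close> from \<open>u\<close>, so that
  \<open>S a = g a + q * S (a + 1)\<close>. Sending \<open>S (dist u v)\<close> from each \<open>v \<noteq> u\<close> to its neighbour closer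
  to \<open>u\<close> gathers \<open>\<mu> u\<close> at \<open>u\<close>. Gathering \<open>\<mu> X\<close> at \<open>X\<close>, moving the unit mass along the geodesic
  to \<open>Y\<close> and spreading it out to \<open>\<mu> Y\<close> yields a net flow from \<open>\<mu> X\<close> to \<open>\<mu> Y\<close>. Since \<open>S\<close> is
  decreasing, this flow is directed towards the geodesic on the half of the tree nearer to \<open>X\<close>, from
  \<open>X\<close> to \<open>Y\<close> on the geodesic, and away from it on the half nearer to \<open>Y\<close>, so a 1-Lipschitz potential
  drops by one along every edge that carries flow. Hence the distance is the difference of the
  expectations of the potential. Its sum over a sphere about \<open>X\<close> depends only on how many vertices of
  the sphere lie behind each vertex of the geodesic.
\<close>

section \<open>Trees\<close>

text \<open>Loops are cut off: when the next vertex already occurs, the path is truncated there.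
  Distinctness is what \<open>graph_cycle\<close> asks for.\<close>

lemma rtrancl_imp_distinct_path:
  assumes "(a, b) \<in> R\<^sup>*"
  shows "\<exists>p. p \<noteq> [] \<and> hd p = a \<and> last p = b \<and> distinct p \<and> successively (\<lambda>u v. (u, v) \<in> R) p"
  using assms
proof (induction rule: rtrancl_induct)
  case base
  show ?case by (rule exI[of _ "[a]"]) simp
next
  case (step b c)
  then obtain p where p: "p \<noteq> []" "hd p = a" "last p = b" "distinct p"
    "successively (\<lambda>u v. (u, v) \<in> R) p" by blast
  show ?case
  proof (cases "c \<in> set p")
    case True
    then obtain xs ys where "p = xs @ c # ys" by (meson split_list)
    then have split: "p = (xs @ [c]) @ ys" by simp
    with p have "distinct (xs @ [c])" "successively (\<lambda>u v. (u, v) \<in> R) (xs @ [c])"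
      "hd (xs @ [c]) = a"
      by (auto simp: successively_append_iff hd_append)
    then show ?thesis by (intro exI[of _ "xs @ [c]"]) simp
  next
    case False
    with p step.hyps show ?thesis
      by (intro exI[of _ "p @ [c]"]) (simp add: successively_append_iff)
  qed
qed

section \<open>Distances in a connected graph\<close>

locale connected_graph =
  fixes V :: "'v set" and E :: "('v \<times> 'v) set"
  assumes simple: "simple_graph V E" and nonempty: "V \<noteq> {}"
    and connected: "\<lbrakk>u \<in> V; v \<in> V\<rbrakk> \<Longrightarrow> (u, v) \<in> E\<^sup>*"
begin

abbreviation dist :: "'v \<Rightarrow> 'v \<Rightarrow> nat" where
  "dist \<equiv> graph_dist E"

lemma edge_sym: "(a, b) \<in> E \<Longrightarrow> (b, a) \<in> E"
  using simple by (auto simp: simple_graph_def sym_def)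

lemma edge_vertices: "(a, b) \<in> E \<Longrightarrow> a \<in> V \<and> b \<in> V"
  using simple by (auto simp: simple_graph_def)

lemma edge_neq: "(a, b) \<in> E \<Longrightarrow> a \<noteq> b"
  using simple by (auto simp: simple_graph_def irrefl_def)

lemma dist_walk: "\<lbrakk>u \<in> V; v \<in> V\<rbrakk> \<Longrightarrow> (u, v) \<in> E ^^ dist u v"
  unfolding graph_dist_def using connected[of u v] by (metis LeastI rtrancl_imp_relpow)

lemma dist_le: "(u, v) \<in> E ^^ n \<Longrightarrow> dist u v \<le> n"
  unfolding graph_dist_def by (rule Least_le)

lemma walk_rev: "(u, v) \<in> E ^^ n \<Longrightarrow> (v, u) \<in> E ^^ n"
proof (induction n arbitrary: v)
  case (Suc n)
  then obtain w where "(u, w) \<in> E ^^ n" "(w, v) \<in> E" by auto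
  with Suc.IH show ?case by (meson edge_sym relpow_Suc_I2)
qed auto

lemma dist_commute: "\<lbrakk>u \<in> V; v \<in> V\<rbrakk> \<Longrightarrow> dist u v = dist v u"
  by (meson dist_walk dist_le walk_rev le_antisym)

lemma dist_refl [simp]: "dist u u = 0"
  using dist_le[of u u 0] by simp

lemma dist_eq_0: "\<lbrakk>u \<in> V; v \<in> V\<rbrakk> \<Longrightarrow> dist u v = 0 \<longleftrightarrow> u = v"
  using dist_walk[of u v] by auto

lemma dist_triangle: "\<lbrakk>u \<in> V; v \<in> V; w \<in> V\<rbrakk> \<Longrightarrow> dist u w \<le> dist u v + dist v w"
  by (rule dist_le) (use dist_walk in \<open>auto simp: relpow_add\<close>)

lemma dist_edge_le: "\<lbrakk>u \<in> V; (v, w) \<in> E\<rbrakk> \<Longrightarrow> dist u w \<le> Suc (dist u v)"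
  by (rule dist_le) (meson dist_walk edge_vertices relpow_Suc_I)

lemma ex_closer:
  assumes "u \<in> V" "v \<in> V" "v \<noteq> u"
  shows "\<exists>w. (v, w) \<in> E \<and> dist u v = Suc (dist u w)"
proof -
  have pos: "dist u v \<noteq> 0" using dist_eq_0 assms by auto
  then obtain n where n: "dist u v = Suc n" using not0_implies_Suc by blast
  then have "(u, v) \<in> E ^^ Suc n" using dist_walk assms by metis
  then obtain w where w: "(u, w) \<in> E ^^ n" "(w, v) \<in> E" by auto
  have "dist u w \<le> n" using w dist_le by simp
  moreover have "dist u v \<le> Suc (dist u w)" using w dist_edge_le assms by simp
  ultimately show ?thesis using w n edge_sym by (intro exI[of _ w]) auto
qed

text \<open>Walk from \<open>a\<close> to \<open>u\<close>, getting closer to \<open>u\<close> at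
  each step: every vertex after \<open>a\<close> is closer to \<open>u\<close> than \<open>v\<close>
  is, and \<open>a\<close> differs from \<open>v\<close> by assumption.\<close>

lemma geodesic_avoids:
  assumes "u \<in> V" "a \<in> V" "v \<noteq> a" "dist u a \<le> dist u v"
  shows "(a, u) \<in> (E \<inter> (- {v}) \<times> (- {v}))\<^sup>*"
  using assms(2-)
proof (induction "dist u a" arbitrary: a)
  case 0
  then show ?case using dist_eq_0 assms(1) by auto
next
  case (Suc n)
  then obtain w where w: "(a, w) \<in> E" "dist u a = Suc (dist u w)"
    using ex_closer[OF assms(1), of a] by fastforce
  have "(w, u) \<in> (E \<inter> (- {v}) \<times> (- {v}))\<^sup>*"
    using Suc w edge_vertices by (intro Suc.hyps(1)) auto
  moreover have "(a, w) \<in> E \<inter> (- {v}) \<times> (- {v})"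
    using Suc w by auto
  ultimately show ?case by (rule converse_rtrancl_into_rtrancl[rotated])
qed

end

section \<open>Trees: parents, geodesics and projections\<close>

locale tree = connected_graph V E for V :: "'v set" and E :: "('v \<times> 'v) set" +
  assumes acyclic: "\<not> graph_cycle E p"
begin

text \<open>Two such neighbours would be joined via \<open>u\<close> by a path avoiding
  \<open>v\<close>, and adding \<open>v\<close> would close a cycle. Admitting equal distances makes
  the lemma yield \<open>dist_edge\<close> as well.\<close>

lemma closer_unique:
  assumes "u \<in> V" and a: "(v, a) \<in> E" "dist u a \<le> dist u v"
    and b: "(v, b) \<in> E" "dist u b \<le> dist u v"
  shows "a = b"
proof (rule ccontr)
  assume "a \<noteq> b"
  let ?R = "E \<inter> (- {v}) \<times> (- {v})"
  have "(a, u) \<in> ?R\<^sup>*" "(b, u) \<in> ?R\<^sup>*"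
    using geodesic_avoids[of u _ v] assms edge_vertices edge_neq by metis+
  moreover have "sym ?R" using edge_sym by (auto simp: sym_def)
  ultimately have "(a, b) \<in> ?R\<^sup>*"
    by (meson rtrancl_trans sym_rtrancl symD)
  from rtrancl_imp_distinct_path[OF this] obtain p where
    p: "p \<noteq> []" "hd p = a" "last p = b" "distinct p" "successively (\<lambda>u v. (u, v) \<in> ?R) p"
    by blast
  have succ: "successively (\<lambda>u v. (u, v) \<in> E) p"
    using p(5) by (rule successively_mono) auto
  \<comment> \<open>As \<open>a \<noteq> b\<close>, the path has at least two vertices, so
    \<open>v # p\<close> reaches the length three required of a cycle.\<close>
  obtain c p' where p': "p = a # c # p'"
    using p \<open>a \<noteq> b\<close> by (metis last_ConsL list.collapse)
  have "w \<noteq> v" if "w \<in> set p" for w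
  proof -
    obtain i where i: "i < length p" "w = p ! i" using \<open>w \<in> set p\<close> by (metis in_set_conv_nth)
    have nth: "(p ! k, p ! Suc k) \<in> ?R" if "Suc k < length p" for k
      using p(5) that by (auto simp: successively_conv_nth)
    show ?thesis
    proof (cases i)
      case 0
      then show ?thesis using nth[of 0] i p' by auto
    next
      case (Suc k)
      then show ?thesis using nth[of k] i by auto
    qed
  qed
  then have "graph_cycle E (v # p)"
    using p succ p' a b edge_sym by (auto simp: graph_cycle_def)
  then show False using acyclic by blast
qed

text \<open>A tree is bipartite: a neighbour at equal distance, together with the neighbour of
  \<open>v\<close> closer to \<open>u\<close>, would contradict
  \<open>closer_unique\<close>.\<close>

lemma dist_edge:
  assumes "u \<in> V" "(v, w) \<in> E"
  shows "dist u w = Suc (dist u v) \<or> dist u v = Suc (dist u w)"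
proof (rule ccontr)
  assume neg: "\<not> ?thesis"
  have "dist u w \<le> Suc (dist u v)" "dist u v \<le> Suc (dist u w)"
    using dist_edge_le assms edge_sym by blast+
  with neg have eq: "dist u w = dist u v" by auto
  have "v \<noteq> u"
    using eq edge_neq[OF assms(2)] dist_eq_0[of u] edge_vertices[OF assms(2)] assms(1) by fastforce
  then obtain c where "(v, c) \<in> E" "dist u v = Suc (dist u c)"
    using ex_closer assms edge_vertices by blast
  with closer_unique[OF assms(1), of v c w] eq assms(2) show False by auto
qed

lemma dist_edge_other:
  assumes "u \<in> V" "(v, a) \<in> E" "dist u v = Suc (dist u a)" "(v, b) \<in> E" "b \<noteq> a"
  shows "dist u b = Suc (dist u v)"
  using closer_unique[OF assms(1), of v a b] dist_edge[OF assms(1), of v b] assms by auto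

text \<open>The directed edges of the geodesic from \<open>X\<close> to \<open>Y\<close>, described
  by distances alone; that they lie on it is \<open>forward_on_geodesic\<close>.\<close>

definition forward :: "'v \<Rightarrow> 'v \<Rightarrow> 'v \<Rightarrow> 'v \<Rightarrow> bool" where
  "forward X Y a b \<longleftrightarrow> (a, b) \<in> E \<and> dist X b = Suc (dist X a) \<and> dist Y a = Suc (dist Y b)"

lemma forward_swap: "forward X Y a b \<longleftrightarrow> forward Y X b a"
  unfolding forward_def using edge_sym by blast

text \<open>Go back from \<open>a\<close> towards \<open>X\<close>. The neighbour \<open>c\<close>
  closer to \<open>X\<close> is not \<open>b\<close>, hence it is farther from \<open>Y\<close>; so
  the edge from \<open>c\<close> to \<open>a\<close> is forward again, and the sum of distances is
  the same at \<open>c\<close>.\<close>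

lemma forward_on_geodesic:
  assumes "X \<in> V" "Y \<in> V" "forward X Y a b"
  shows "dist X a + dist Y a = dist X Y"
  using assms(3)
proof (induction "dist X a" arbitrary: a b)
  case 0
  then show ?case
    using dist_eq_0[of X a] edge_vertices assms dist_commute[of X Y] by (auto simp: forward_def)
next
  case (Suc n)
  from Suc.prems have ab: "(a, b) \<in> E" "a \<in> V" using edge_vertices by (auto simp: forward_def)
  obtain c where c: "(a, c) \<in> E" "dist X a = Suc (dist X c)"
    using ex_closer[of X a] Suc.hyps(2) assms(1) ab by fastforce
  have "c \<noteq> b" using c Suc.prems by (auto simp: forward_def)
  then have "dist Y c = Suc (dist Y a)"
    using dist_edge_other[of Y a b c] Suc.prems assms c by (auto simp: forward_def)
  then have "forward X Y c a" using c edge_sym by (auto simp: forward_def)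
  from Suc.hyps(1)[OF _ this] Suc.hyps(2) c this show ?case by (auto simp: forward_def)
qed

text \<open>A step closer to both \<open>X\<close> and \<open>Y\<close> would push the sum of the
  distances below \<open>dist X Y\<close>.\<close>

lemma closer_is_forward:
  assumes "X \<in> V" "Y \<in> V" "(a, b) \<in> E" "dist X a + dist Y a = dist X Y" "dist Y a = Suc (dist Y b)"
  shows "forward X Y a b"
proof -
  have "dist X Y \<le> dist X b + dist Y b"
    using dist_triangle[of X b Y] dist_commute[of b Y] edge_vertices assms by auto
  then have "dist X b \<noteq> dist X a - 1 \<or> dist X a = 0" using assms by auto
  then show ?thesis using dist_edge[of X a b] assms by (auto simp: forward_def)
qed

text \<open>\<open>j\<close> is the index of the projection of \<open>v\<close> to the path and
  \<open>h\<close> the distance to it. As the path never turns back, the distance to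
  \<open>v\<close> keeps increasing once it has increased.\<close>

lemma dist_along_path:
  assumes v: "v \<in> V" and path: "\<And>i. i < m \<Longrightarrow> (p i, p (Suc i)) \<in> E"
    and inj: "inj_on p {..m}"
  shows "\<exists>j\<le>m. \<exists>h. \<forall>i\<le>m. int (dist v (p i)) = int h + \<bar>int i - int j\<bar>"
  using path inj
proof (induction m)
  case 0
  show ?case by auto
next
  case (Suc m)
  have "inj_on p {..m}" by (rule inj_on_subset[OF Suc.prems(2)]) auto
  with Suc obtain j h where j: "j \<le> m"
    and h: "\<And>i. i \<le> m \<Longrightarrow> int (dist v (p i)) = int h + \<bar>int i - int j\<bar>" by fastforce
  have e: "(p m, p (Suc m)) \<in> E" using Suc.prems by simp
  show ?case
  proof (cases "dist v (p (Suc m)) = Suc (dist v (p m))")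
    case True
    then have "\<forall>i\<le>Suc m. int (dist v (p i)) = int h + \<bar>int i - int j\<bar>"
      using h h[of m] j by (auto simp: le_Suc_eq)
    then show ?thesis using j le_SucI by blast
  next
    case False
    then have closer: "dist v (p m) = Suc (dist v (p (Suc m)))" using dist_edge[OF v e] by blast
    \<comment> \<open>Otherwise the distance rose before the last step, and \<open>p k\<close> and
      \<open>p (Suc m)\<close> are two neighbours of \<open>p m\<close> closer to
      \<open>v\<close>.\<close>
    have "j = m"
    proof (rule ccontr)
      assume "j \<noteq> m"
      with j obtain k where k: "m = Suc k" "j \<le> k" by (cases m) auto
      have "(p m, p k) \<in> E" using Suc.prems k edge_sym by simp
      moreover have "dist v (p m) = Suc (dist v (p k))" using h[of m] h[of k] k by auto
      moreover have "p k \<noteq> p (Suc m)" using inj_onD[OF Suc.prems(2), of k "Suc m"] k by auto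
      ultimately show False
        using dist_edge_other[OF v, of "p m" "p k" "p (Suc m)"] e False by auto
    qed
    \<comment> \<open>The projection moves on to \<open>p (Suc m)\<close>. The difference
      \<open>h - 1\<close> is not truncated, because \<open>h = dist v (p m)\<close> is
      positive.\<close>
    moreover have "int (dist v (p i)) = int (h - 1) + \<bar>int i - int (Suc m)\<bar>" if "i \<le> Suc m" for i
      using h[of i] h[of m] closer \<open>j = m\<close> that by (cases "i = Suc m") auto
    ultimately show ?thesis by blast
  qed
qed

end

section \<open>Vertex counts in a regular tree\<close>

locale regular_tree_graph = tree V E for V :: "'v set" and E :: "('v \<times> 'v) set" +
  fixes q :: nat
  assumes q_pos: "q \<ge> 1"
    and finite_nbrs: "u \<in> V \<Longrightarrow> finite (E `` {u})"
    and card_nbrs: "u \<in> V \<Longrightarrow> card (E `` {u}) = Suc q"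
begin

definition children :: "'v \<Rightarrow> 'v \<Rightarrow> 'v set" where
  "children u v = {w. (v, w) \<in> E \<and> dist u w = Suc (dist u v)}"

lemma finite_children: "v \<in> V \<Longrightarrow> finite (children u v)"
  by (rule finite_subset[OF _ finite_nbrs]) (auto simp: children_def)

lemma nbrs_root: "u \<in> V \<Longrightarrow> E `` {u} = children u u"
  using dist_edge[of u u] by (auto simp: children_def)

lemma nbrs_split:
  assumes "u \<in> V" "v \<in> V" "v \<noteq> u"
  shows "\<exists>c. E `` {v} = insert c (children u v) \<and> c \<notin> children u v \<and> dist u v = Suc (dist u c)"
proof -
  obtain c where c: "(v, c) \<in> E" "dist u v = Suc (dist u c)" using ex_closer assms by blast
  have "E `` {v} = insert c (children u v)"
    using c dist_edge_other[OF assms(1) c] by (auto simp: children_def)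
  with c show ?thesis by (intro exI[of _ c]) (auto simp: children_def)
qed

lemma card_children:
  assumes "u \<in> V" "v \<in> V"
  shows "card (children u v) = (if v = u then Suc q else q)"
proof (cases "v = u")
  case True
  then show ?thesis using nbrs_root card_nbrs assms by simp
next
  case False
  then obtain c where "E `` {v} = insert c (children u v)" "c \<notin> children u v"
    using nbrs_split assms by blast
  then have "Suc q = Suc (card (children u v))"
    using card_nbrs[OF assms(2)] finite_children[OF assms(2), of u] by simp
  then show ?thesis using False by simp
qed

text \<open>With the tree rooted at \<open>u\<close>, the vertices \<open>k\<close> generations
  below \<open>p\<close>: equality in the triangle inequality says that \<open>p\<close> lies
  between \<open>u\<close> and \<open>v\<close>.\<close>

definition descendants :: "'v \<Rightarrow> 'v \<Rightarrow> nat \<Rightarrow> 'v set" where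
  "descendants u p k = {v \<in> V. dist p v = k \<and> dist u v = dist u p + k}"

lemma descendants_subset: "descendants u p k \<subseteq> V"
  by (auto simp: descendants_def)

lemma descendants_0: "p \<in> V \<Longrightarrow> descendants u p 0 = {p}"
  using dist_eq_0 by (auto simp: descendants_def)

text \<open>The triangle inequality through \<open>p\<close> shows that the neighbour of
  \<open>w\<close> closer to \<open>p\<close> is closer to \<open>u\<close> too.\<close>

lemma descendants_Suc:
  assumes "u \<in> V" "p \<in> V"
  shows "descendants u p (Suc k) = (\<Union>v\<in>descendants u p k. children u v)"
proof (intro equalityI subsetI)
  fix w assume "w \<in> descendants u p (Suc k)"
  then have w: "w \<in> V" "dist p w = Suc k" "dist u w = dist u p + Suc k"
    by (auto simp: descendants_def)
  then obtain v where v: "(w, v) \<in> E" "dist p w = Suc (dist p v)"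
    using ex_closer[of p w] assms by fastforce
  have "v \<in> V" using v edge_vertices by blast
  moreover have "dist u v \<le> dist u p + k"
    using dist_triangle[of u p v] assms v w \<open>v \<in> V\<close> by auto
  moreover have "dist u w \<le> Suc (dist u v)" using dist_edge_le assms v edge_sym by blast
  ultimately show "w \<in> (\<Union>v\<in>descendants u p k. children u v)"
    using v w edge_sym by (auto simp: descendants_def children_def intro!: exI[of _ v])
next
  fix w assume "w \<in> (\<Union>v\<in>descendants u p k. children u v)"
  then obtain v where v: "v \<in> V" "dist p v = k" "dist u v = dist u p + k" "(v, w) \<in> E"
    "dist u w = Suc (dist u v)"
    by (auto simp: descendants_def children_def)
  have "w \<in> V" using v edge_vertices by blast
  moreover have "dist u w \<le> dist u p + dist p w" using dist_triangle assms \<open>w \<in> V\<close> by blast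
  moreover have "dist p w \<le> Suc k" using dist_edge_le v assms by blast
  ultimately show "w \<in> descendants u p (Suc k)" using v by (auto simp: descendants_def)
qed

lemma finite_descendants: "\<lbrakk>u \<in> V; p \<in> V\<rbrakk> \<Longrightarrow> finite (descendants u p k)"
proof (induction k)
  case (Suc k)
  then show ?case
    using finite_children descendants_subset by (fastforce simp: descendants_Suc)
qed (simp add: descendants_0)

lemma card_descendants_Suc:
  assumes "u \<in> V" "p \<in> V"
  shows "card (descendants u p (Suc k)) = (\<Sum>v\<in>descendants u p k. if v = u then Suc q else q)"
proof -
  have "card (descendants u p (Suc k)) = (\<Sum>v\<in>descendants u p k. card (children u v))"
    unfolding descendants_Suc[OF assms]
  proof (rule card_UN_disjoint)
    show "finite (descendants u p k)" using finite_descendants assms by blast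
    show "\<forall>v\<in>descendants u p k. finite (children u v)"
      using finite_children descendants_subset by blast
    show "\<forall>i\<in>descendants u p k. \<forall>j\<in>descendants u p k. i \<noteq> j \<longrightarrow> children u i \<inter> children u j = {}"
    proof (intro ballI impI equals0I)
      fix i j w assume "i \<noteq> j" "w \<in> children u i \<inter> children u j"
      then show False using closer_unique[OF assms(1), of w i j] edge_sym by (auto simp: children_def)
    qed
  qed
  also have "\<dots> = (\<Sum>v\<in>descendants u p k. if v = u then Suc q else q)"
    by (intro sum.cong refl card_children) (use assms in \<open>auto simp: descendants_def\<close>)
  finally show ?thesis .
qed

lemma card_descendants:
  assumes "u \<in> V" "p \<in> V" "p \<noteq> u"
  shows "card (descendants u p k) = q ^ k"
proof (induction k)
  case (Suc k)
  have "dist u p \<noteq> 0" using dist_eq_0 assms by auto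
  then have "u \<notin> descendants u p k" by (auto simp: descendants_def)
  then have "card (descendants u p (Suc k)) = (\<Sum>v\<in>descendants u p k. q)"
    unfolding card_descendants_Suc[OF assms(1,2)] by (intro sum.cong) auto
  with Suc show ?case by simp
qed (simp add: descendants_0 assms)

definition sphere :: "'v \<Rightarrow> nat \<Rightarrow> 'v set" where
  "sphere u k = {v \<in> V. dist u v = k}"

lemma sphere_eq_descendants: "sphere u k = descendants u u k"
  by (auto simp: sphere_def descendants_def)

lemma finite_sphere: "u \<in> V \<Longrightarrow> finite (sphere u k)"
  by (simp add: sphere_eq_descendants finite_descendants)

lemma card_sphere_Suc:
  assumes "u \<in> V"
  shows "card (sphere u (Suc k)) = (q + 1) * q ^ k"
proof (induction k)
  case 0
  show ?case
    using card_descendants_Suc[OF assms assms, of 0]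
    by (simp add: sphere_eq_descendants descendants_0 assms)
next
  case (Suc k)
  have "u \<notin> sphere u (Suc k)" by (auto simp: sphere_def)
  then have "card (sphere u (Suc (Suc k))) = (\<Sum>v\<in>sphere u (Suc k). q)"
    unfolding sphere_eq_descendants card_descendants_Suc[OF assms assms]
    by (intro sum.cong) auto
  with Suc show ?case by (simp add: algebra_simps)
qed

lemma card_sphere:
  assumes "u \<in> V"
  shows "card (sphere u k) = (if k = 0 then 1 else (q + 1) * q ^ (k - 1))"
  using card_sphere_Suc[OF assms] assms
  by (cases k) (auto simp: sphere_eq_descendants descendants_0)

lemma sphere_nonempty: "u \<in> V \<Longrightarrow> sphere u k \<noteq> {}"
  using card_sphere[of u k] q_pos by (auto split: if_splits)

end

section \<open>Transport along a flow\<close>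

text \<open>Mass at \<open>a\<close> jumps to \<open>b\<close> with probability
  \<open>m / pmf A a\<close> and everything else stays; pairing start with end gives a coupling
  inside \<open>R\<close>.\<close>

lemma rel_pmf_move:
  fixes A :: "'a pmf"
  assumes "reflp R" "R a b" "a \<noteq> b" "0 \<le> m" "m \<le> pmf A a"
  shows "\<exists>A'. rel_pmf R A A' \<and>
    (\<forall>y. pmf A' y = pmf A y + m * (of_bool (y = b) - of_bool (y = a)))"
proof (cases "pmf A a = 0")
  case True
  have "rel_pmf R A A" by (rule rel_pmf_reflI) (use assms(1) in \<open>auto simp: reflp_def\<close>)
  then show ?thesis using assms True by auto
next
  case False
  then have pos: "pmf A a > 0" using pmf_nonneg[of A a] by linarith
  define p where "p = m / pmf A a"
  have p: "0 \<le> p" "p \<le> 1" "p * pmf A a = m" using assms pos by (auto simp: p_def)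
  define K where "K x = (if x = a then map_pmf (\<lambda>t. if t then b else a) (bernoulli_pmf p)
    else return_pmf x)" for x
  have "rel_pmf R (bind_pmf A return_pmf) (bind_pmf A K)"
  proof (rule rel_pmf_bindI)
    show "rel_pmf (=) A A" by (simp add: pmf.rel_eq)
    fix x y :: 'a assume "x = y"
    then show "rel_pmf R (return_pmf x) (K y)"
      using assms(1,2) by (auto simp: K_def rel_pmf_return_pmf1 reflp_def)
  qed
  moreover have "pmf (bind_pmf A K) y = pmf A y + m * (of_bool (y = b) - of_bool (y = a))" for y
  proof -
    \<comment> \<open>Written with indicators, the kernel integrates against \<open>A\<close> to
      values of \<open>pmf A\<close>.\<close>
    have K: "pmf (K x) y = indicator {y} x + p * (of_bool (y = b) - of_bool (y = a)) * indicator {a} x"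
      for x
    proof (cases "x = a")
      case True
      have "pmf (K x) y = measure (bernoulli_pmf p) ((\<lambda>t. if t then b else a) -` {y})"
        using True by (simp add: K_def pmf_map)
      also have "(\<lambda>t. if t then b else a) -` {y} =
        (if y = b then {True} else if y = a then {False} else {})"
        using assms(3) by (auto split: if_splits)
      finally show ?thesis
        using True p assms(3) by (auto simp: measure_pmf_single indicator_def)
    next
      case False
      then show ?thesis by (auto simp: K_def indicator_def pmf_return)
    qed
    have "pmf (bind_pmf A K) y = measure_pmf.expectation A
      (\<lambda>x. indicator {y} x + p * (of_bool (y = b) - of_bool (y = a)) * indicator {a} x)"
      unfolding pmf_bind K by simp
    also have "\<dots> = pmf A y + p * (of_bool (y = b) - of_bool (y = a)) * pmf A a"
      by (subst Bochner_Integration.integral_add)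
        (auto simp: measure_pmf_single measure_pmf.emeasure_eq_measure intro!: integrable_real_indicator)
    also have "\<dots> = pmf A y + m * (of_bool (y = b) - of_bool (y = a))"
      using p(3) by (metis mult.commute mult.assoc)
    finally show ?thesis .
  qed
  ultimately show ?thesis unfolding bind_return_pmf' by blast
qed

text \<open>The rank \<open>r\<close> rules out circulation, so the flow can be carried out edge by
  edge; transitivity of \<open>R\<close> composes the moves.\<close>

lemma rel_pmf_flow:
  fixes A B :: "'a pmf" and r :: "'a \<Rightarrow> real" and \<phi> :: "'a \<times> 'a \<Rightarrow> real"
  assumes "reflp R" "transp R" "finite \<Phi>"
    and "\<And>a b. (a, b) \<in> \<Phi> \<Longrightarrow> R a b \<and> r b < r a \<and> 0 \<le> \<phi> (a, b)"
    and "\<And>v. pmf B v = pmf A v + (\<Sum>(a, b)\<in>\<Phi>. \<phi> (a, b) * (of_bool (v = b) - of_bool (v = a)))"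
  shows "rel_pmf R A B"
  using assms(3-)
proof (induction "card \<Phi>" arbitrary: A \<Phi>)
  case 0
  then have "B = A" by (intro pmf_eqI) simp
  then show ?case using assms(1) by (auto intro!: rel_pmf_reflI simp: reflp_def)
next
  case (Suc n)
  \<comment> \<open>Emptying the highest vertices first guarantees that the mass to be moved is present.\<close>
  have "finite ((r \<circ> fst) ` \<Phi>)" "(r \<circ> fst) ` \<Phi> \<noteq> {}" using Suc by auto
  then obtain e where "e \<in> \<Phi>" "r (fst e) = Max ((r \<circ> fst) ` \<Phi>)"
    by (metis (mono_tags, lifting) Max_in comp_apply imageE)
  then obtain a b where ab: "(a, b) \<in> \<Phi>" and top: "\<And>a' b'. (a', b') \<in> \<Phi> \<Longrightarrow> r a' \<le> r a"
    using Suc.prems(1) by (cases e) (force intro: Max_ge)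
  let ?f = "\<lambda>v (x, y). \<phi> (x, y) * (of_bool (v = y) - of_bool (v = x))"
  \<comment> \<open>An edge entering \<open>a\<close> would start above the maximal rank, so no edge
    adds mass at \<open>a\<close>.\<close>
  have nonpos: "?f a e \<le> 0" if "e \<in> \<Phi>" for e
    using Suc.prems(2) top that by (cases e) (fastforce simp: not_less)
  have "(\<Sum>e\<in>\<Phi>. ?f a e) = ?f a (a, b) + (\<Sum>e\<in>\<Phi> - {(a, b)}. ?f a e)"
    using Suc.prems(1) ab by (intro sum.remove) auto
  also have "(\<Sum>e\<in>\<Phi> - {(a, b)}. ?f a e) \<le> 0"
    by (rule sum_nonpos) (use nonpos in blast)
  also have "?f a (a, b) + 0 = - \<phi> (a, b)" using Suc.prems(2)[OF ab] by auto
  finally have le: "\<phi> (a, b) \<le> pmf A a"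
    using Suc.prems(3)[of a] pmf_nonneg[of B a] by linarith
  obtain A' where A': "rel_pmf R A A'"
    "\<And>y. pmf A' y = pmf A y + \<phi> (a, b) * (of_bool (y = b) - of_bool (y = a))"
    using rel_pmf_move[OF assms(1), of a b "\<phi> (a, b)" A] Suc.prems(2)[OF ab] le by auto
  have "rel_pmf R A' B"
  proof (rule Suc.hyps(1)[of "\<Phi> - {(a, b)}"])
    show "n = card (\<Phi> - {(a, b)})" using Suc.hyps(2) Suc.prems(1) ab by simp
    show "pmf B v = pmf A' v + (\<Sum>e\<in>\<Phi> - {(a, b)}. ?f v e)" for v
      using Suc.prems(3)[of v] A'(2)[of v] sum.remove[OF Suc.prems(1) ab, of "?f v"] by simp
  qed (use Suc.prems in auto)
  with A'(1) show ?case
    using pmf.rel_transp[OF assms(2)] by (meson transpD)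
qed

text \<open>The easy half of Kantorovich duality: the expectation of \<open>f v - f w\<close>
  depends only on the marginals, bounds the cost of every coupling from below, and equals the cost
  of the coupling behind \<open>tight\<close>.\<close>

lemma W1_eq_potential:
  assumes fin: "finite (set_pmf \<mu>)" "finite (set_pmf \<nu>)"
    and lip: "\<And>v w. \<lbrakk>v \<in> set_pmf \<mu>; w \<in> set_pmf \<nu>\<rbrakk> \<Longrightarrow> f v - f w \<le> real (graph_dist E v w)"
    and tight: "rel_pmf (\<lambda>v w. f v - f w = real (graph_dist E v w)) \<mu> \<nu>"
  shows "W1 E \<mu> \<nu> = measure_pmf.expectation \<mu> f - measure_pmf.expectation \<nu> f"
proof -
  have expect: "measure_pmf.expectation \<pi> (\<lambda>(v, w). f v - f w) =
      measure_pmf.expectation \<mu> f - measure_pmf.expectation \<nu> f"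
    and finp: "finite (set_pmf \<pi>)" and sub: "set_pmf \<pi> \<subseteq> set_pmf \<mu> \<times> set_pmf \<nu>"
    if "\<pi> \<in> couplings \<mu> \<nu>" for \<pi>
  proof -
    have m: "\<mu> = map_pmf fst \<pi>" "\<nu> = map_pmf snd \<pi>" using that by (auto simp: couplings_def)
    then show sub: "set_pmf \<pi> \<subseteq> set_pmf \<mu> \<times> set_pmf \<nu>" by force
    then show finp: "finite (set_pmf \<pi>)" using fin finite_subset by blast
    show "measure_pmf.expectation \<pi> (\<lambda>(v, w). f v - f w) =
      measure_pmf.expectation \<mu> f - measure_pmf.expectation \<nu> f"
      unfolding m integral_map_pmf case_prod_beta using finp
      by (intro Bochner_Integration.integral_diff integrable_measure_pmf_finite)
  qed
  show ?thesis
    unfolding W1_def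
  proof (rule Least_equality)
    obtain \<pi> where \<pi>: "\<And>v w. (v, w) \<in> set_pmf \<pi> \<Longrightarrow> f v - f w = real (graph_dist E v w)"
      "map_pmf fst \<pi> = \<mu>" "map_pmf snd \<pi> = \<nu>"
      using tight by (auto elim: rel_pmf.cases)
    then have c: "\<pi> \<in> couplings \<mu> \<nu>" by (simp add: couplings_def)
    have "transport_cost E \<pi> = measure_pmf.expectation \<pi> (\<lambda>(v, w). f v - f w)"
      unfolding transport_cost_def
      by (intro integral_cong_AE) (auto simp: AE_measure_pmf_iff \<pi>(1))
    with expect[OF c] c
    show "\<exists>\<pi>\<in>couplings \<mu> \<nu>. measure_pmf.expectation \<mu> f - measure_pmf.expectation \<nu> f =
        transport_cost E \<pi>" by force
  next
    fix c assume "\<exists>\<pi>\<in>couplings \<mu> \<nu>. c = transport_cost E \<pi>"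
    then obtain \<pi> where \<pi>: "\<pi> \<in> couplings \<mu> \<nu>" "c = transport_cost E \<pi>" by blast
    have "measure_pmf.expectation \<pi> (\<lambda>(v, w). f v - f w) \<le> transport_cost E \<pi>"
      unfolding transport_cost_def using finp[OF \<pi>(1)] sub[OF \<pi>(1)] lip
      by (intro integral_mono_AE integrable_measure_pmf_finite) (auto simp: AE_measure_pmf_iff)
    then show "measure_pmf.expectation \<mu> f - measure_pmf.expectation \<nu> f \<le> c"
      using expect[OF \<pi>(1)] \<pi>(2) by simp
  qed
qed

section \<open>Radial measures on a regular tree\<close>

context tree
begin

lemma dist_adjacent: "(a, b) \<in> E \<Longrightarrow> dist a b = 1"
  using dist_edge[of a a b] edge_vertices by auto

text \<open>In a walk of minimal length the vertex \<open>p i\<close> is at most \<open>i\<close>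
  steps from \<open>X\<close>, and being closer would shorten the walk to \<open>Y\<close>.\<close>

lemma ex_geodesic:
  assumes "X \<in> V" "Y \<in> V"
  shows "\<exists>p. p 0 = X \<and> p (dist X Y) = Y \<and> (\<forall>i < dist X Y. (p i, p (Suc i)) \<in> E) \<and>
    (\<forall>i \<le> dist X Y. p i \<in> V \<and> dist X (p i) = i)"
proof -
  let ?d = "dist X Y"
  obtain p where p: "p 0 = X" "p ?d = Y" "\<And>i. i < ?d \<Longrightarrow> (p i, p (Suc i)) \<in> E"
    using dist_walk[OF assms] unfolding relpow_fun_conv by auto
  have V: "p i \<in> V" if "i \<le> ?d" for i
  proof (cases i)
    case (Suc k)
    then show ?thesis using that p(3)[of k] edge_vertices by auto
  qed (simp add: p assms)
  have up: "dist X (p i) \<le> i" if "i \<le> ?d" for i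
    using that
  proof (induction i)
    case (Suc i)
    then show ?case using dist_edge_le[OF assms(1) p(3)[of i]] by simp
  qed (simp add: p)
  have "?d \<le> dist X (p i) + (?d - i)" if "i \<le> ?d" for i
    using that
  proof (induction i rule: inc_induct)
    case (step i)
    then show ?case using dist_edge_le[OF assms(1) p(3)[of i]] by simp
  qed (simp add: p)
  then have "dist X (p i) = i" if "i \<le> ?d" for i
    using up[OF that] that by fastforce
  with p V show ?thesis by blast
qed

text \<open>The signed distance to the midpoint of the geodesic, positive on the side of
  \<open>X\<close>. If the midpoint is a vertex, the potential is zero on everything that hangs off
  it.\<close>

definition potential :: "'v \<Rightarrow> 'v \<Rightarrow> 'v \<Rightarrow> real" where
  "potential X Y v =
    (if dist X v < dist Y v then real (dist Y v) - real (dist X Y) / 2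
     else if dist Y v < dist X v then real (dist X Y) / 2 - real (dist X v) else 0)"

lemma potential_swap: "\<lbrakk>X \<in> V; Y \<in> V\<rbrakk> \<Longrightarrow> potential Y X v = - potential X Y v"
  by (auto simp: potential_def dist_commute)

lemma edge_cases:
  assumes "X \<in> V" "Y \<in> V" "(a, b) \<in> E"
  obtains (forward) "forward X Y a b" | (backward) "forward Y X a b"
  | (up) "dist X a = Suc (dist X b)" "dist Y a = Suc (dist Y b)"
  | (down) "dist X b = Suc (dist X a)" "dist Y b = Suc (dist Y a)"
  using dist_edge[of X a b] dist_edge[of Y a b] assms by (auto simp: forward_def)

text \<open>On the geodesic all three branches of the definition agree with
  \<open>dist X Y / 2 - dist X v\<close>.\<close>

lemma potential_forward:
  assumes "X \<in> V" "Y \<in> V" "forward X Y a b"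
  shows "potential X Y a = potential X Y b + 1"
proof -
  have "dist X a + dist Y a = dist X Y" using forward_on_geodesic assms by blast
  moreover have "dist X b = Suc (dist X a)" "dist Y a = Suc (dist Y b)"
    using assms by (auto simp: forward_def)
  ultimately show ?thesis by (auto simp: potential_def field_simps)
qed

text \<open>Off the geodesic both distances change in the same way, so both ends fall under the same
  branch of the definition.\<close>

lemma potential_edge:
  assumes "X \<in> V" "Y \<in> V" "(a, b) \<in> E"
  shows "potential X Y a - potential X Y b \<le> 1"
  using assms
proof (cases rule: edge_cases)
  case forward
  then show ?thesis using potential_forward assms by simp
next
  case backward
  then have "forward X Y b a" using forward_swap by blast
  then show ?thesis using potential_forward assms by fastforce
qed (auto simp: potential_def)

lemma potential_lipschitz:
  assumes "X \<in> V" "Y \<in> V" "v \<in> V" "w \<in> V"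
  shows "potential X Y v - potential X Y w \<le> real (dist v w)"
proof -
  have "potential X Y v - potential X Y w \<le> real n" if "(v, w) \<in> E ^^ n" for n
    using that
  proof (induction n arbitrary: w)
    case (Suc n)
    then obtain x where "(v, x) \<in> E ^^ n" "(x, w) \<in> E" by auto
    then show ?case using Suc.IH[of x] potential_edge[OF assms(1,2), of x w] by auto
  qed auto
  then show ?thesis using dist_walk assms by blast
qed

end

section \<open>Tails, flows and optimality\<close>

locale radial_measures = regular_tree_graph V E q
  for V :: "'v set" and E :: "('v \<times> 'v) set" and q :: nat +
  fixes \<mu> :: "'v \<Rightarrow> 'v pmf" and g :: "nat \<Rightarrow> real" and L :: nat
  assumes support: "u \<in> V \<Longrightarrow> set_pmf (\<mu> u) \<subseteq> V"
    and radial: "\<lbrakk>u \<in> V; v \<in> V\<rbrakk> \<Longrightarrow> pmf (\<mu> u) v = g (dist u v)"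
    and vanish: "l \<ge> L \<Longrightarrow> g l = 0"
begin

text \<open>Spheres of every radius are nonempty, so each value of \<open>g\<close> occurs as a
  probability.\<close>

lemma g_nonneg: "0 \<le> g l"
proof -
  obtain u where u: "u \<in> V" using nonempty by blast
  then obtain v where "v \<in> sphere u l" using sphere_nonempty by blast
  then show ?thesis using radial[OF u, of v] pmf_nonneg[of "\<mu> u" v] by (auto simp: sphere_def)
qed

lemma set_pmf_subset: "u \<in> V \<Longrightarrow> set_pmf (\<mu> u) \<subseteq> (\<Union>l<L. sphere u l)"
proof
  fix v assume u: "u \<in> V" and v: "v \<in> set_pmf (\<mu> u)"
  then have "v \<in> V" "g (dist u v) \<noteq> 0" using support[of u] radial[of u v] by (auto simp: set_pmf_iff)
  then have "dist u v < L" using vanish[of "dist u v"] by (meson linorder_not_less)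
  then show "v \<in> (\<Union>l<L. sphere u l)" using \<open>v \<in> V\<close> by (auto simp: sphere_def)
qed

lemma finite_set_pmf_radial: "u \<in> V \<Longrightarrow> finite (set_pmf (\<mu> u))"
  by (rule finite_subset[OF set_pmf_subset]) (auto simp: finite_sphere)

lemma expectation_radial:
  fixes f :: "'v \<Rightarrow> real"
  assumes u: "u \<in> V"
  shows "measure_pmf.expectation (\<mu> u) f = (\<Sum>l<L. g l * (\<Sum>v\<in>sphere u l. f v))"
proof -
  have "measure_pmf.expectation (\<mu> u) f = (\<Sum>v\<in>(\<Union>l<L. sphere u l). f v * pmf (\<mu> u) v)"
    by (rule integral_measure_pmf_real) (use set_pmf_subset[OF u] finite_sphere[OF u] in auto)
  also have "\<dots> = (\<Sum>l<L. \<Sum>v\<in>sphere u l. f v * pmf (\<mu> u) v)"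
    by (rule sum.UNION_disjoint) (use finite_sphere[OF u] in \<open>auto simp: sphere_def\<close>)
  also have "\<dots> = (\<Sum>l<L. g l * (\<Sum>v\<in>sphere u l. f v))"
    unfolding sum_distrib_left
    by (intro sum.cong refl) (use radial[OF u] in \<open>auto simp: sphere_def\<close>)
  finally show ?thesis .
qed

\<comment> \<open>The mass that \<open>\<mu> u\<close> puts on the branch behind a vertex at distance \<open>a\<close> from \<open>u\<close>.\<close>
definition tail :: "nat \<Rightarrow> real" where
  "tail a = (\<Sum>l=a..<L. real q ^ (l - a) * g l)"

lemma tail_step: "tail a = g a + real q * tail (Suc a)"
proof (cases "a < L")
  case True
  then have "tail a = g a + (\<Sum>l=Suc a..<L. real q ^ (l - a) * g l)"
    by (simp add: tail_def sum.atLeast_Suc_lessThan)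
  also have "(\<Sum>l=Suc a..<L. real q ^ (l - a) * g l) = real q * tail (Suc a)"
    unfolding tail_def sum_distrib_left
  proof (intro sum.cong refl)
    fix l assume "l \<in> {Suc a..<L}"
    then have "l - a = Suc (l - Suc a)" by auto
    then show "real q ^ (l - a) * g l = real q * (real q ^ (l - Suc a) * g l)" by simp
  qed
  finally show ?thesis .
qed (simp add: tail_def vanish)

lemma tail_nonneg: "0 \<le> tail a"
  unfolding tail_def by (intro sum_nonneg mult_nonneg_nonneg g_nonneg) auto

lemma tail_vanish: "a \<ge> L \<Longrightarrow> tail a = 0"
  by (simp add: tail_def)

text \<open>Immediate from \<open>tail_step\<close> and \<open>q \<ge> 1\<close>; it decides the
  direction of the net flow off the geodesic.\<close>

lemma tail_antimono: "a \<le> b \<Longrightarrow> tail b \<le> tail a"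
proof (induction b rule: dec_induct)
  case (step b)
  have "1 * tail (Suc b) \<le> real q * tail (Suc b)"
    using q_pos tail_nonneg by (intro mult_right_mono) auto
  with step tail_step[of b] g_nonneg[of b] show ?case by simp
qed simp

text \<open>There are \<open>q + 1\<close> branches at \<open>u\<close>, each of mass
  \<open>tail 1\<close>.\<close>

lemma total_mass: "g 0 + (real q + 1) * tail 1 = 1"
proof -
  obtain u where u: "u \<in> V" using nonempty by blast
  have 1: "1 = (\<Sum>l<L. g l * real (card (sphere u l)))"
    using expectation_radial[OF u, of "\<lambda>_. 1"] by simp
  then have "L > 0" by (cases L) auto
  then have "(\<Sum>l<L. g l * real (card (sphere u l))) =
      g 0 + (\<Sum>l=1..<L. g l * real (card (sphere u l)))"
    by (simp add: lessThan_atLeast0 sum.atLeast_Suc_lessThan card_sphere[OF u])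
  also have "(\<Sum>l=1..<L. g l * real (card (sphere u l))) = (real q + 1) * tail 1"
    unfolding tail_def sum_distrib_left
    by (intro sum.cong refl) (auto simp: card_sphere[OF u] algebra_simps)
  finally show ?thesis using 1 by simp
qed

\<comment> \<open>The flow that gathers the measure of \<open>u\<close> at the vertex \<open>u\<close>.\<close>
definition gather :: "'v \<Rightarrow> 'v \<Rightarrow> 'v \<Rightarrow> real" where
  "gather u a b = (if dist u b < dist u a then tail (dist u a) else - tail (dist u b))"

text \<open>A vertex \<open>a \<noteq> u\<close> passes \<open>tail (dist u a)\<close> to its parent
  and receives \<open>tail (Suc (dist u a))\<close> from each of \<open>q\<close> children, so
  \<open>tail_step\<close> applies; at \<open>u\<close> the whole mass collects, by
  \<open>total_mass\<close>.\<close>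

lemma divergence_gather:
  assumes "u \<in> V" "a \<in> V"
  shows "(\<Sum>b\<in>E `` {a}. gather u a b) = g (dist u a) - of_bool (a = u)"
proof -
  have "(\<Sum>b\<in>children u a. gather u a b) = (\<Sum>b\<in>children u a. - tail (Suc (dist u a)))"
    by (intro sum.cong) (auto simp: gather_def children_def)
  then have ch: "(\<Sum>b\<in>children u a. gather u a b) = - (if a = u then real q + 1 else real q) * tail (Suc (dist u a))"
    by (simp add: card_children assms algebra_simps)
  show ?thesis
  proof (cases "a = u")
    case True
    then show ?thesis using ch nbrs_root[OF assms(1)] total_mass by (simp add: algebra_simps)
  next
    case False
    then obtain c where c: "E `` {a} = insert c (children u a)" "c \<notin> children u a"
      "dist u a = Suc (dist u c)"
      using nbrs_split assms by blast
    have "(\<Sum>b\<in>E `` {a}. gather u a b) = gather u a c + (\<Sum>b\<in>children u a. gather u a b)"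
      unfolding c(1) using c(2) finite_children[OF assms(2)] by simp
    also have "gather u a c = tail (dist u a)" using c(3) by (simp add: gather_def)
    finally show ?thesis using ch False tail_step[of "dist u a"] by simp
  qed
qed

text \<open>Each vertex of the geodesic other than \<open>Y\<close> has exactly one forward edge,
  the one towards \<open>Y\<close>.\<close>

lemma sum_forward:
  assumes "X \<in> V" "Y \<in> V" "a \<in> V"
  shows "(\<Sum>b\<in>E `` {a}. of_bool (forward X Y a b)) =
    (of_bool (dist X a + dist Y a = dist X Y \<and> a \<noteq> Y) :: real)"
proof (cases "dist X a + dist Y a = dist X Y \<and> a \<noteq> Y")
  case True
  then obtain c where c: "(a, c) \<in> E" "dist Y a = Suc (dist Y c)"
    using ex_closer[OF assms(2,3)] by blast
  have "forward X Y a b \<longleftrightarrow> b = c" if "b \<in> E `` {a}" for b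
  proof
    assume "forward X Y a b"
    then have "(a, b) \<in> E" "dist Y b \<le> dist Y a" by (auto simp: forward_def)
    moreover have "dist Y c \<le> dist Y a" unfolding c(2) by simp
    ultimately show "b = c" using closer_unique[OF assms(2)] c(1) by blast
  next
    assume "b = c"
    then show "forward X Y a b" using closer_is_forward[OF assms(1,2) c(1) _ c(2)] True by blast
  qed
  then have "(\<Sum>b\<in>E `` {a}. of_bool (forward X Y a b)) = (\<Sum>b\<in>E `` {a}. if b = c then 1 else 0 :: real)"
    by (intro sum.cong) auto
  also have "\<dots> = 1" using c finite_nbrs[OF assms(3)] by simp
  finally show ?thesis using True by simp
next
  case False
  have "\<not> forward X Y a b" for b
    using forward_on_geodesic[OF assms(1,2), of a b] False by (auto simp: forward_def)
  then show ?thesis using False by simp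
qed

text \<open>Net amounts: opposite contributions to the same edge cancel, which removes the detours
  of the mass through \<open>X\<close> and \<open>Y\<close>.\<close>

definition current :: "'v \<Rightarrow> 'v \<Rightarrow> 'v \<Rightarrow> 'v \<Rightarrow> real" where
  "current X Y a b = gather X a b - gather Y a b
    + (of_bool (forward X Y a b) - of_bool (forward Y X a b))"

text \<open>The unit flow along the geodesic starts at \<open>X\<close> and ends at
  \<open>Y\<close>, so it cancels the point masses left over from the two gatherings.\<close>

lemma divergence_current:
  assumes "X \<in> V" "Y \<in> V" "a \<in> V"
  shows "(\<Sum>b\<in>E `` {a}. current X Y a b) = g (dist X a) - g (dist Y a)"
proof -
  have "(\<Sum>b\<in>E `` {a}. of_bool (forward X Y a b)) - (\<Sum>b\<in>E `` {a}. of_bool (forward Y X a b))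
      = (of_bool (a = X) - of_bool (a = Y) :: real)"
    unfolding sum_forward[OF assms] sum_forward[OF assms(2,1,3)]
    using dist_commute[of X Y] assms by auto
  then show ?thesis
    unfolding current_def sum.distrib sum_subtractf
    using divergence_gather assms by simp
qed

lemma current_antisym:
  assumes "X \<in> V" "Y \<in> V" "(a, b) \<in> E"
  shows "current X Y b a = - current X Y a b"
proof -
  have "gather u b a = - gather u a b" if "u \<in> V" for u
    using dist_edge[OF that assms(3)] unfolding gather_def
    by (elim disjE) simp_all
  then show ?thesis
    unfolding current_def forward_swap[of X Y a b] forward_swap[of Y X a b]
    by (simp only: assms)
qed

text \<open>This is complementary slackness: only edges along which the potential drops by one carry
  flow.\<close>

lemma current_pos_imp_potential:
  assumes "X \<in> V" "Y \<in> V" "(a, b) \<in> E" "current X Y a b > 0"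
  shows "potential X Y a = potential X Y b + 1"
  using assms(1-3)
proof (cases rule: edge_cases)
  case forward
  then show ?thesis using potential_forward assms by blast
next
  case backward
  then have "current X Y a b = tail (dist X a) + tail (dist Y b) - 1" "dist X a \<ge> 1" "dist Y b \<ge> 1"
    by (auto simp: current_def gather_def forward_def)
  moreover have "tail (dist X a) \<le> tail 1" "tail (dist Y b) \<le> tail 1"
    using calculation tail_antimono by auto
  \<comment> \<open>Two branches together weigh at most 1, so nothing flows against the unit mass on
    the geodesic.\<close>
  moreover have "2 * tail 1 \<le> (real q + 1) * tail 1"
    using q_pos tail_nonneg by (intro mult_right_mono) auto
  ultimately show ?thesis using total_mass g_nonneg[of 0] assms(4) by linarith
next
  case up
  then have "current X Y a b = tail (dist X a) - tail (dist Y a)"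
    by (auto simp: current_def gather_def forward_def)
  then have "dist X a < dist Y a" using assms(4) tail_antimono[of "dist Y a" "dist X a"] by linarith
  with up show ?thesis by (auto simp: potential_def)
next
  case down
  then have "current X Y a b = tail (dist Y b) - tail (dist X b)"
    by (auto simp: current_def gather_def forward_def)
  then have "dist Y b < dist X b" using assms(4) tail_antimono[of "dist X b" "dist Y b"] by linarith
  with down show ?thesis by (auto simp: potential_def)
qed

lemma finite_current_support:
  assumes "X \<in> V" "Y \<in> V"
  shows "finite {(a, b) \<in> E. current X Y a b > 0}" (is "finite ?\<Phi>")
proof -
  let ?N = "L + dist X Y"
  define B where "B = (\<Union>k\<le>?N. sphere X k) \<union> (\<Union>k\<le>?N. sphere Y k)"
  have "a \<in> B" if e: "(a, b) \<in> E" and pos: "current X Y a b > 0" for a b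
  proof -
    have a: "a \<in> V" using edge_vertices e by blast
    \<comment> \<open>If \<open>a\<close> is farther than \<open>L\<close> from \<open>u\<close>,
      then \<open>b\<close> is at distance at least \<open>L\<close>, and the tails at both ends
      vanish.\<close>
    have small: "dist u a \<le> L" if "u \<in> V" "gather u a b \<noteq> 0" for u
      using tail_vanish[of "dist u a"] tail_vanish[of "dist u b"] dist_edge[OF that(1) e] that(2)
      by (cases "dist u a \<ge> L") (auto simp: gather_def split: if_splits)
    consider "gather X a b \<noteq> 0" | "gather Y a b \<noteq> 0" | "forward X Y a b"
      using pos unfolding current_def
      by (cases "gather X a b = 0"; cases "gather Y a b = 0"; cases "forward X Y a b")
        (auto simp: of_bool_def split: if_splits)
    then have "dist X a \<le> ?N \<or> dist Y a \<le> ?N"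
      using small assms forward_on_geodesic[OF assms, of a b] by cases force+
    then show ?thesis using a by (auto simp: B_def sphere_def)
  qed
  then have "?\<Phi> \<subseteq> Sigma B (\<lambda>a. E `` {a})" by auto
  moreover have "finite (Sigma B (\<lambda>a. E `` {a}))"
    using assms finite_sphere finite_nbrs by (intro finite_SigmaI) (auto simp: B_def sphere_def)
  ultimately show ?thesis by (rule finite_subset)
qed

text \<open>By antisymmetry the inflow over an edge at \<open>v\<close> is the negative part of the
  current leaving \<open>v\<close>; inflow minus outflow is therefore minus the divergence.\<close>

lemma current_conservation:
  assumes "X \<in> V" "Y \<in> V"
  shows "pmf (\<mu> Y) v = pmf (\<mu> X) v +
    (\<Sum>(a, b)\<in>{(a, b) \<in> E. current X Y a b > 0}. current X Y a b * (of_bool (v = b) - of_bool (v = a)))"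
    (is "_ = _ + sum _ ?\<Phi>")
proof -
  let ?J = "current X Y"
  have fin: "finite ?\<Phi>" using finite_current_support assms by blast
  have finN: "finite (E `` {v})"
    using finite_nbrs[of v] edge_vertices by (metis Image_singleton_iff ex_in_conv finite.emptyI)
  have "(\<Sum>(a, b)\<in>?\<Phi>. ?J a b * of_bool (v = b)) = (\<Sum>e\<in>{e \<in> ?\<Phi>. snd e = v}. ?J (fst e) (snd e))"
    using fin by (intro sum.mono_neutral_cong_right) auto
  also have "{e \<in> ?\<Phi>. snd e = v} = (\<lambda>b. (b, v)) ` {b \<in> E `` {v}. ?J b v > 0}"
    using edge_sym by auto
  also have "(\<Sum>e\<in>\<dots>. ?J (fst e) (snd e)) = (\<Sum>b\<in>{b \<in> E `` {v}. ?J b v > 0}. ?J b v)"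
    by (subst sum.reindex) (auto simp: inj_on_def)
  also have "\<dots> = (\<Sum>b\<in>E `` {v}. max 0 (- ?J v b))"
    using finN current_antisym[OF assms]
    by (intro sum.mono_neutral_cong_left) (auto simp: max_def)
  finally have inflow: "(\<Sum>(a, b)\<in>?\<Phi>. ?J a b * of_bool (v = b)) = (\<Sum>b\<in>E `` {v}. max 0 (- ?J v b))" .
  have "(\<Sum>(a, b)\<in>?\<Phi>. ?J a b * of_bool (v = a)) = (\<Sum>e\<in>{e \<in> ?\<Phi>. fst e = v}. ?J (fst e) (snd e))"
    using fin by (intro sum.mono_neutral_cong_right) auto
  also have "{e \<in> ?\<Phi>. fst e = v} = (\<lambda>b. (v, b)) ` {b \<in> E `` {v}. ?J v b > 0}"
    by auto
  also have "(\<Sum>e\<in>\<dots>. ?J (fst e) (snd e)) = (\<Sum>b\<in>{b \<in> E `` {v}. ?J v b > 0}. ?J v b)"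
    by (subst sum.reindex) (auto simp: inj_on_def)
  also have "\<dots> = (\<Sum>b\<in>E `` {v}. max 0 (?J v b))"
    using finN by (intro sum.mono_neutral_cong_left) (auto simp: max_def)
  finally have outflow: "(\<Sum>(a, b)\<in>?\<Phi>. ?J a b * of_bool (v = a)) = (\<Sum>b\<in>E `` {v}. max 0 (?J v b))" .
  have "(\<Sum>(a, b)\<in>?\<Phi>. ?J a b * (of_bool (v = b) - of_bool (v = a))) =
      (\<Sum>b\<in>E `` {v}. max 0 (- ?J v b)) - (\<Sum>b\<in>E `` {v}. max 0 (?J v b))"
    unfolding inflow[symmetric] outflow[symmetric] sum_subtractf[symmetric]
    by (intro sum.cong) (auto simp: algebra_simps)
  also have "\<dots> = - (\<Sum>b\<in>E `` {v}. ?J v b)"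
    unfolding sum_subtractf[symmetric] sum_negf[symmetric] by (intro sum.cong) auto
  also have "\<dots> = pmf (\<mu> Y) v - pmf (\<mu> X) v"
  proof (cases "v \<in> V")
    case True
    then show ?thesis using divergence_current[OF assms True] radial assms by simp
  next
    case False
    then have "E `` {v} = {}" "pmf (\<mu> X) v = 0" "pmf (\<mu> Y) v = 0"
      using edge_vertices support assms by (auto simp: pmf_eq_0_set_pmf)
    then show ?thesis by simp
  qed
  finally show ?thesis by simp
qed

lemma W1_eq_potential_diff:
  assumes "X \<in> V" "Y \<in> V"
  shows "W1 E (\<mu> X) (\<mu> Y) = measure_pmf.expectation (\<mu> X) (potential X Y)
    - measure_pmf.expectation (\<mu> Y) (potential X Y)"
proof (rule W1_eq_potential)
  show "finite (set_pmf (\<mu> X))" "finite (set_pmf (\<mu> Y))"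
    using finite_set_pmf_radial assms by auto
  show "potential X Y v - potential X Y w \<le> real (dist v w)"
    if "v \<in> set_pmf (\<mu> X)" "w \<in> set_pmf (\<mu> Y)" for v w
    using potential_lipschitz support assms that by blast
  \<comment> \<open>The diagonal is added so that \<open>R\<close> is reflexive on the whole type,
    not only on \<open>V\<close>; equal vertices are tight pairs anyway.\<close>
  define R where "R v w \<longleftrightarrow>
    v = w \<or> v \<in> V \<and> w \<in> V \<and> potential X Y v - potential X Y w = real (dist v w)" for v w
  have "rel_pmf R (\<mu> X) (\<mu> Y)"
  proof (rule rel_pmf_flow[where r = "potential X Y" and \<phi> = "\<lambda>(a, b). current X Y a b"
        and \<Phi> = "{(a, b) \<in> E. current X Y a b > 0}"])
    show "reflp R" by (auto simp: R_def reflp_def)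
    \<comment> \<open>The potential differences of two tight pairs add up to at least
      \<open>dist x z\<close> by the triangle inequality, and to at most that by the Lipschitz
      bound.\<close>
    show "transp R"
    proof (rule transpI)
      fix x y z assume xyz: "R x y" "R y z"
      show "R x z"
      proof (cases "x = y \<or> y = z")
        case False
        then have V: "x \<in> V" "y \<in> V" "z \<in> V"
          and "potential X Y x - potential X Y z = real (dist x y) + real (dist y z)"
          using xyz by (auto simp: R_def)
        moreover have "dist x z \<le> dist x y + dist y z" using dist_triangle V by blast
        moreover have "potential X Y x - potential X Y z \<le> real (dist x z)"
          using potential_lipschitz assms V by blast
        ultimately show ?thesis by (auto simp: R_def)
      qed (use xyz in auto)
    qed
    show "finite {(a, b) \<in> E. current X Y a b > 0}" using finite_current_support assms by blast
    show "R a b \<and> potential X Y b < potential X Y a \<and> 0 \<le> (case (a, b) of (a, b) \<Rightarrow> current X Y a b)"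
      if "(a, b) \<in> {(a, b) \<in> E. current X Y a b > 0}" for a b
      using that current_pos_imp_potential[OF assms, of a b] dist_adjacent[of a b] edge_vertices[of a b]
      by (auto simp: R_def)
    show "pmf (\<mu> Y) v = pmf (\<mu> X) v + (\<Sum>(a, b)\<in>{(a, b) \<in> E. current X Y a b > 0}.
        (case (a, b) of (a, b) \<Rightarrow> current X Y a b) * (of_bool (v = b) - of_bool (v = a)))" for v
      using current_conservation[OF assms, of v] by simp
  qed
  then show "rel_pmf (\<lambda>v w. potential X Y v - potential X Y w = real (dist v w)) (\<mu> X) (\<mu> Y)"
    by (rule pmf.rel_mono_strong) (auto simp: R_def)
qed

end

section \<open>The value of the potential\<close>

\<comment> \<open>The potential at a vertex at distance \<open>l\<close> from \<open>X\<close> whose projection to the geodesic from \<open>X\<close> to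
  \<open>Y\<close> has distance \<open>i\<close> from \<open>X\<close>, where \<open>d = dist X Y\<close>.\<close>
definition profile :: "nat \<Rightarrow> nat \<Rightarrow> nat \<Rightarrow> real" where
  "profile d l i = (if 2 * i < d then real l + real d / 2 - 2 * real i
     else if 2 * i = d then 0 else real d / 2 - real l)"

text \<open>Summation by parts over the index of the projection: for
  \<open>1 \<le> i \<le> l\<close>, there are \<open>q ^ (l - i)\<close> vertices of the sphere of
  radius \<open>l\<close> that lie behind the geodesic vertex with index \<open>i\<close>.\<close>

definition sphere_sum :: "nat \<Rightarrow> nat \<Rightarrow> nat \<Rightarrow> real" where
  "sphere_sum q d l = profile d l 0 * (if l = 0 then 1 else (real q + 1) * real q ^ (l - 1))
    + (\<Sum>i=1..d. (profile d l i - profile d l (i - 1)) * (if i \<le> l then real q ^ (l - i) else 0))"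

context regular_tree_graph
begin

text \<open>A vertex projecting to index \<open>j\<close> lies behind exactly the geodesic vertices
  with index at most \<open>j\<close>, so the increments of \<open>profile\<close> telescope to its
  potential.\<close>

lemma sum_potential_sphere:
  assumes X: "X \<in> V" and Y: "Y \<in> V"
  shows "(\<Sum>v\<in>sphere X l. potential X Y v) = sphere_sum q (dist X Y) l"
proof -
  define d where "d = dist X Y"
  obtain p where p: "p 0 = X" "p d = Y" "\<And>i. i < d \<Longrightarrow> (p i, p (Suc i)) \<in> E"
    "\<And>i. i \<le> d \<Longrightarrow> p i \<in> V" "\<And>i. i \<le> d \<Longrightarrow> dist X (p i) = i"
    using ex_geodesic[OF X Y] unfolding d_def by metis
  have inj: "inj_on p {..d}" by (rule inj_on_inverseI[of _ "dist X"]) (simp add: p)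
  let ?D = "\<lambda>i. if i \<le> l then descendants X (p i) (l - i) else {}"
  let ?\<Delta> = "\<lambda>i. profile d l i - profile d l (i - 1)"
  have pot: "potential X Y v = profile d l 0 + (\<Sum>i=1..d. ?\<Delta> i * of_bool (v \<in> ?D i))"
    if v: "v \<in> sphere X l" for v
  proof -
    have vV: "v \<in> V" "dist X v = l" using v by (auto simp: sphere_def)
    obtain j h where j: "j \<le> d"
      and h: "\<And>i. i \<le> d \<Longrightarrow> int (dist v (p i)) = int h + \<bar>int i - int j\<bar>"
      using dist_along_path[OF vV(1) p(3) inj] by blast
    have h': "int (dist (p i) v) = int h + \<bar>int i - int j\<bar>" if "i \<le> d" for i
      using h[OF that] dist_commute[OF vV(1) p(4)[OF that]] by simp
    have l: "l = h + j" using h'[of 0] p vV by simp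
    have dY: "int (dist Y v) = int h + int d - int j" using h'[of d] p j by simp
    \<comment> \<open>Since \<open>l = h + j\<close>, the distance
      \<open>h + \<bar>i - j\<bar>\<close> equals \<open>l - i\<close> precisely for
      \<open>i \<le> j\<close>.\<close>
    have "v \<in> ?D i \<longleftrightarrow> i \<le> j" if "i \<le> d" for i
      using h'[OF that] p(5)[OF that] vV l by (auto simp: descendants_def)
    then have "(\<Sum>i=1..d. ?\<Delta> i * of_bool (v \<in> ?D i)) = (\<Sum>i=1..j. ?\<Delta> i)"
      using j by (intro sum.mono_neutral_cong_right) auto
    also have "\<dots> = profile d l j - profile d l 0"
      using sum_telescope''[of 0 j "profile d l"] by simp
    finally have "profile d l 0 + (\<Sum>i=1..d. ?\<Delta> i * of_bool (v \<in> ?D i)) = profile d l j" by simp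
    also have "\<dots> = potential X Y v"
      using dY l j vV(2) unfolding potential_def profile_def d_def[symmetric] by auto
    finally show ?thesis ..
  qed
  have card: "(\<Sum>v\<in>sphere X l. of_bool (v \<in> ?D i)) = (if i \<le> l then real q ^ (l - i) else 0)"
    if "1 \<le> i" "i \<le> d" for i
  proof -
    have "p i \<noteq> X" using p(5)[OF that(2)] that(1) by fastforce
    then have c: "card (descendants X (p i) (l - i)) = q ^ (l - i)"
      using card_descendants X p(4)[OF that(2)] by blast
    have "?D i \<subseteq> sphere X l"
      using p(5)[OF that(2)] by (auto simp: descendants_def sphere_def)
    then have "sphere X l \<inter> ?D i = ?D i" by blast
    then show ?thesis
      using c finite_sphere[OF X, of l] by (simp add: sum_of_bool_eq Int_def flip: of_nat_power)
  qed
  have "(\<Sum>v\<in>sphere X l. potential X Y v) =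
      (\<Sum>v\<in>sphere X l. profile d l 0 + (\<Sum>i=1..d. ?\<Delta> i * of_bool (v \<in> ?D i)))"
    using pot by (intro sum.cong) auto
  also have "\<dots> = profile d l 0 * real (card (sphere X l))
      + (\<Sum>v\<in>sphere X l. \<Sum>i=1..d. ?\<Delta> i * of_bool (v \<in> ?D i))"
    by (simp add: sum.distrib)
  also have "(\<Sum>v\<in>sphere X l. \<Sum>i=1..d. ?\<Delta> i * of_bool (v \<in> ?D i))
      = (\<Sum>i=1..d. ?\<Delta> i * (\<Sum>v\<in>sphere X l. of_bool (v \<in> ?D i)))"
    unfolding sum_distrib_left by (rule sum.swap)
  also have "\<dots> = (\<Sum>i=1..d. ?\<Delta> i * (if i \<le> l then real q ^ (l - i) else 0))"
    using card by (intro sum.cong) auto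
  finally show ?thesis
    by (simp add: sphere_sum_def card_sphere[OF X] d_def[symmetric] distrib_right)
qed

end

text \<open>Exchanging \<open>X\<close> and \<open>Y\<close> negates the potential, so both
  expectations contribute the same sum; hence the factor 2.\<close>

lemma (in radial_measures) W1_radial:
  assumes "X \<in> V" "Y \<in> V"
  shows "W1 E (\<mu> X) (\<mu> Y) = (\<Sum>l<L. g l * (2 * sphere_sum q (dist X Y) l))"
proof -
  have "W1 E (\<mu> X) (\<mu> Y) = measure_pmf.expectation (\<mu> X) (potential X Y)
      + measure_pmf.expectation (\<mu> Y) (potential Y X)"
    unfolding W1_eq_potential_diff[OF assms] potential_swap[OF assms] by simp
  also have "\<dots> = (\<Sum>l<L. g l * sphere_sum q (dist X Y) l) + (\<Sum>l<L. g l * sphere_sum q (dist Y X) l)"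
    by (simp add: expectation_radial sum_potential_sphere assms)
  finally show ?thesis
    using dist_commute[OF assms] by (simp flip: sum_distrib_left add: mult.left_commute[of _ 2])
qed

section \<open>Closed forms of the sphere sums\<close>

text \<open>Truncated subtraction suits the formula: for \<open>m > l\<close> the additional
  summands vanish and \<open>Q ^ (l - m)\<close> stays 1.\<close>

lemma sum_decreasing_powers:
  fixes Q :: real
  assumes "Q \<noteq> 1"
  shows "(\<Sum>i=1..m. if i \<le> l then Q ^ (l - i) else 0) = (Q ^ l - Q ^ (l - m)) / (Q - 1)"
proof (induction m)
  case (Suc m)
  show ?case
  proof (cases "Suc m \<le> l")
    case True
    then have "Q ^ (l - m) = Q * Q ^ (l - Suc m)" by (metis Suc_diff_Suc Suc_le_eq power_Suc)
    with Suc True assms show ?thesis by (simp add: field_simps)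
  qed (use Suc in simp)
qed simp

text \<open>On the half of \<open>X\<close> each step lowers \<open>profile\<close> by 2, crossing
  the middle edge adds \<open>- 2 * (l - m)\<close>, and beyond it \<open>profile\<close> is
  constant.\<close>

lemma sphere_sum_odd:
  assumes "q \<ge> 2"
  shows "sphere_sum q (2 * m + 1) l =
    (real l + real m + 1 / 2) * (if l = 0 then 1 else (real q + 1) * real q ^ (l - 1))
    - 2 * (real q ^ l - real q ^ (l - m)) / (real q - 1)
    - 2 * (real l - real m) * (if Suc m \<le> l then real q ^ (l - Suc m) else 0)"
proof -
  let ?d = "2 * m + 1" and ?w = "\<lambda>i. if i \<le> l then real q ^ (l - i) else 0"
  let ?\<Delta> = "\<lambda>i. profile ?d l i - profile ?d l (i - 1)"
  have p0: "profile ?d l 0 = real l + real m + 1 / 2" by (simp add: profile_def field_simps)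
  have "(\<Sum>i=1..?d. ?\<Delta> i * ?w i) = (\<Sum>i=1..Suc m. ?\<Delta> i * ?w i)"
    by (rule sum.mono_neutral_right) (auto simp: profile_def)
  also have "\<dots> = (\<Sum>i=1..m. ?\<Delta> i * ?w i) + ?\<Delta> (Suc m) * ?w (Suc m)" by simp
  also have "?\<Delta> (Suc m) = - (2 * (real l - real m))" by (auto simp: profile_def field_simps)
  also have "(\<Sum>i=1..m. ?\<Delta> i * ?w i) = (\<Sum>i=1..m. - 2 * ?w i)"
    by (intro sum.cong refl) (auto simp: profile_def of_nat_diff)
  also have "\<dots> = - (2 * (real q ^ l - real q ^ (l - m)) / (real q - 1))"
    unfolding sum_distrib_left[symmetric]
    by (subst sum_decreasing_powers) (use assms in \<open>auto simp: minus_divide_left\<close>)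
  finally show ?thesis unfolding sphere_sum_def p0 by linarith
qed

text \<open>The midpoint is now the vertex with index \<open>Suc m\<close>, where
  \<open>profile\<close> is 0, so the change across the middle splits into two increments.\<close>

lemma sphere_sum_even:
  assumes "q \<ge> 2"
  shows "sphere_sum q (2 * m + 2) l =
    (real l + real m + 1) * (if l = 0 then 1 else (real q + 1) * real q ^ (l - 1))
    - 2 * (real q ^ l - real q ^ (l - m)) / (real q - 1)
    - (real l - real m + 1) * (if Suc m \<le> l then real q ^ (l - Suc m) else 0)
    - (real l - real m - 1) * (if Suc (Suc m) \<le> l then real q ^ (l - Suc (Suc m)) else 0)"
proof -
  let ?d = "2 * m + 2" and ?w = "\<lambda>i. if i \<le> l then real q ^ (l - i) else 0"
  let ?\<Delta> = "\<lambda>i. profile ?d l i - profile ?d l (i - 1)"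
  have p0: "profile ?d l 0 = real l + real m + 1" by (simp add: profile_def field_simps)
  have "(\<Sum>i=1..?d. ?\<Delta> i * ?w i) = (\<Sum>i=1..Suc (Suc m). ?\<Delta> i * ?w i)"
    by (rule sum.mono_neutral_right) (auto simp: profile_def)
  also have "\<dots> = (\<Sum>i=1..m. ?\<Delta> i * ?w i) + ?\<Delta> (Suc m) * ?w (Suc m)
      + ?\<Delta> (Suc (Suc m)) * ?w (Suc (Suc m))" by simp
  also have "?\<Delta> (Suc m) = - (real l - real m + 1)" by (auto simp: profile_def field_simps)
  also have "?\<Delta> (Suc (Suc m)) = - (real l - real m - 1)" by (auto simp: profile_def field_simps)
  also have "(\<Sum>i=1..m. ?\<Delta> i * ?w i) = (\<Sum>i=1..m. - 2 * ?w i)"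
    by (intro sum.cong refl) (auto simp: profile_def of_nat_diff)
  also have "\<dots> = - (2 * (real q ^ l - real q ^ (l - m)) / (real q - 1))"
    unfolding sum_distrib_left[symmetric]
    by (subst sum_decreasing_powers) (use assms in \<open>auto simp: minus_divide_left\<close>)
  finally show ?thesis unfolding sphere_sum_def p0 by linarith
qed

text \<open>The first two terms extend the expression valid for large \<open>l\<close> to all
  \<open>l\<close>. At \<open>l = 0\<close> this would give the sphere \<open>(Q + 1) / Q\<close>
  vertices instead of 1, whence the term with \<open>of_bool (l = 0)\<close>; the last term repairs
  the powers truncated for \<open>l \<le> m\<close>.\<close>

lemma coefficient_odd:
  fixes Q :: real
  assumes "Q > 1" "Q = real q"
  shows "2 * sphere_sum q (2 * m + 1) l =
    (2 * Q + 2 - 2 * Q powi (1 - int (Suc m)) - 2 * Q powi (- int m)) * (real l * Q ^ (l - 1))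
    + (real (2 * m + 1) + real (2 * m + 1) / Q - 4 / (Q - 1)
        + 2 * real (Suc m) * Q powi (- int (Suc m)) + 2 / (Q - 1) * Q powi (- int (Suc m))
        + 2 * real m * Q powi (- 1 - int m) + 2 / (Q - 1) * Q powi (- int m)) * Q ^ l
    - real (2 * m + 1) / Q * of_bool (l = 0)
    + of_bool (l \<le> m) * (4 / (Q - 1)
         + (2 * real l - 2 * real (Suc m) - 2 / (Q - 1)) * Q powi (int l - int (Suc m))
         + (2 * real l / Q - 2 * real m / Q - 2 / (Q - 1)) * Q powi (int l - int m))"
proof -
  \<comment> \<open>With \<open>x\<close> and \<open>a\<close> as atoms every power becomes a
    monomial, and the claim an identity of rational functions.\<close>
  define x a where "x = Q ^ l" and "a = Q ^ m"
  have pos: "Q > 0" "Q \<noteq> 0" "a > 0" "Q - 1 > 0" using assms by (auto simp: a_def)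
  have q2: "q \<ge> 2" using assms by auto
  have pw: "Q powi (1 - int (Suc m)) = 1 / a" "Q powi (- int m) = 1 / a"
    "Q powi (- int (Suc m)) = 1 / (a * Q)" "Q powi (- 1 - int m) = 1 / (a * Q)"
    "Q powi (int l - int (Suc m)) = x / (a * Q)" "Q powi (int l - int m) = x / a"
    using pos by (simp_all add: power_int_diff power_int_minus power_int_add power2_eq_square x_def a_def field_simps)
  have lx: "real l * Q ^ (l - 1) = real l * x / Q"
    using pos by (cases l) (auto simp: x_def)
  have e: "(real l + real m + 1 / 2) * (if l = 0 then 1 else (Q + 1) * Q ^ (l - 1)) =
     (real l + real m + 1 / 2) * ((Q + 1) * x / Q) - (real m + 1 / 2) / Q * of_bool (l = 0)"
    using pos by (cases l) (auto simp: x_def field_simps)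
  have A: "sphere_sum q (2 * m + 1) l =
    (real l + real m + 1 / 2) * ((Q + 1) * x / Q) - (real m + 1 / 2) / Q * of_bool (l = 0)
    - 2 * (x - Q ^ (l - m)) / (Q - 1)
    - 2 * (real l - real m) * (if Suc m \<le> l then Q ^ (l - Suc m) else 0)"
    unfolding sphere_sum_odd[OF q2] assms(2)[symmetric] e x_def[symmetric] ..
  show ?thesis
  proof (cases "l \<le> m")
    case True
    then show ?thesis unfolding A pw lx x_def[symmetric]
      using pos by (simp add: divide_simps) (simp add: algebra_simps)
  next
    case False
    then have pl: "Q ^ (l - m) = x / a" "Q ^ (l - Suc m) = x / (a * Q)"
      using pos by (auto simp: x_def a_def power_diff)
    show ?thesis unfolding A pw lx pl x_def[symmetric]
      using pos False by (simp add: divide_simps) (simp add: algebra_simps)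
  qed
qed

lemma coefficient_even:
  fixes Q :: real
  assumes "Q > 1" "Q = real q"
  shows "2 * sphere_sum q (2 * m + 2) l =
    (2 * Q + 2 - 2 * Q powi (1 - int (Suc m)) - 2 * Q powi (- int (Suc m))) * (real l * Q ^ (l - 1))
    + (real (2 * m + 2) + real (2 * m + 2) / Q - 4 / (Q - 1)
        + 2 * real (Suc m) * Q powi (- int (Suc m)) + 2 / (Q - 1) * Q powi (- int (Suc m))
        + 2 * real (Suc m) * Q powi (- 1 - int (Suc m)) + 2 / (Q - 1) * Q powi (- int (Suc m))) * Q ^ l
    - real (2 * m + 2) / Q * of_bool (l = 0)
    + of_bool (l \<le> Suc m) * (4 / (Q - 1)
         + (2 * real l - 2 * real (Suc m) - 2 / (Q - 1)) * Q powi (int l - int (Suc m))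
         + (2 * real l / Q - 2 * real (Suc m) / Q - 2 / (Q - 1)) * Q powi (int l - int (Suc m)))"
proof -
  define x a where "x = Q ^ l" and "a = Q ^ m"
  have pos: "Q > 0" "Q \<noteq> 0" "a > 0" "Q - 1 > 0" using assms by (auto simp: a_def)
  have q2: "q \<ge> 2" using assms by auto
  have pw: "Q powi (1 - int (Suc m)) = 1 / a"
    "Q powi (- int (Suc m)) = 1 / (a * Q)" "Q powi (- 1 - int (Suc m)) = 1 / (a * Q * Q)"
    "Q powi (int l - int (Suc m)) = x / (a * Q)"
    using pos by (simp_all add: power_int_diff power_int_minus power_int_add power2_eq_square x_def a_def field_simps)
  have lx: "real l * Q ^ (l - 1) = real l * x / Q"
    using pos by (cases l) (auto simp: x_def)
  have e: "(real l + real m + 1) * (if l = 0 then 1 else (Q + 1) * Q ^ (l - 1)) =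
     (real l + real m + 1) * ((Q + 1) * x / Q) - (real m + 1) / Q * of_bool (l = 0)"
    using pos by (cases l) (auto simp: x_def field_simps)
  have A: "sphere_sum q (2 * m + 2) l =
    (real l + real m + 1) * ((Q + 1) * x / Q) - (real m + 1) / Q * of_bool (l = 0)
    - 2 * (x - Q ^ (l - m)) / (Q - 1)
    - (real l - real m + 1) * (if Suc m \<le> l then Q ^ (l - Suc m) else 0)
    - (real l - real m - 1) * (if Suc (Suc m) \<le> l then Q ^ (l - Suc (Suc m)) else 0)"
    unfolding sphere_sum_even[OF q2] assms(2)[symmetric] e x_def[symmetric] ..
  consider "l \<le> m" | "l = Suc m" | "l \<ge> Suc (Suc m)" by linarith
  then show ?thesis
  proof cases
    case 1
    then show ?thesis unfolding A pw lx x_def[symmetric]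
      using pos by (simp add: divide_simps) (simp add: algebra_simps)
  next
    \<comment> \<open>The power dropped at \<open>l = Suc m\<close> has the coefficient
      \<open>l - m - 1 = 0\<close>.\<close>
    case 2
    then have "x = a * Q" by (simp add: x_def a_def)
    with 2 show ?thesis unfolding A pw lx x_def[symmetric]
      using pos by (simp add: divide_simps) (simp add: algebra_simps)
  next
    case 3
    then have pl: "Q ^ (l - m) = x / a" "Q ^ (l - Suc m) = x / (a * Q)" "Q ^ (l - Suc (Suc m)) = x / (a * Q * Q)"
      using pos by (auto simp: x_def a_def power_diff)
    show ?thesis unfolding A pw lx pl x_def[symmetric]
      using pos 3 by (simp add: divide_simps) (simp add: algebra_simps)
  qed
qed

section \<open>Coefficients of the generating functions and the final formula\<close>

lemma eval_gen_G:
  assumes "\<And>l. l \<ge> L \<Longrightarrow> g l n = 0"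
  shows "fps_nth (eval_x (gen_G g) x) n = (\<Sum>l<L. g l n * x ^ l)"
  unfolding eval_x_def gen_G_def eval_fps_def using assms
  by (simp, intro suminf_finite) auto

lemma eval_gen_G1:
  assumes "\<And>l. l \<ge> L \<Longrightarrow> g l n = 0"
  shows "fps_nth (eval_x (gen_G1 g) x) n = (\<Sum>l<L. g l n * (real l * x ^ (l - 1)))"
proof -
  have "fps_nth (eval_x (gen_G1 g) x) n = (\<Sum>l. real (Suc l) * g (Suc l) n * x ^ l)"
    by (simp add: eval_x_def gen_G1_def deriv_x_def gen_G_def eval_fps_def)
  also have "\<dots> = (\<Sum>l<L. real (Suc l) * g (Suc l) n * x ^ l)"
    using assms by (intro suminf_finite) auto
  \<comment> \<open>The index is shifted by one; the new summand at \<open>l = 0\<close> has the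
    factor 0.\<close>
  also have "\<dots> = (\<Sum>l<Suc L. g l n * (real l * x ^ (l - 1)))"
    by (subst sum.lessThan_Suc_shift) (simp add: algebra_simps)
  also have "\<dots> = (\<Sum>l<L. g l n * (real l * x ^ (l - 1)))"
    using assms by simp
  finally show ?thesis .
qed

lemma regular_tree_graphI:
  assumes "regular_tree (q + 1) V E" "q \<ge> 1"
  shows "regular_tree_graph V E q"
  using assms
  by unfold_locales (auto simp: regular_tree_def graph_tree_def)

theorem theorem6p1:
  fixes q d :: nat
    and V :: "'v set" and E :: "('v \<times> 'v) set"
    and \<mu> :: "'v \<Rightarrow> nat \<Rightarrow> 'v pmf"
    and g :: "nat \<Rightarrow> nat \<Rightarrow> real"
    and X Y :: 'v
    and \<delta> \<delta>' n :: nat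
  assumes "q \<ge> 2" and "d \<ge> 1"
    and "regular_tree (q + 1) V E"
    and "\<And>u m. u \<in> V \<Longrightarrow> finite (set_pmf (\<mu> u m)) \<and> set_pmf (\<mu> u m) \<subseteq> V"
    and "\<And>u v u' v' m. \<lbrakk>u \<in> V; v \<in> V; u' \<in> V; v' \<in> V; graph_dist E u v = graph_dist E u' v'\<rbrakk>
           \<Longrightarrow> pmf (\<mu> u m) v = pmf (\<mu> u' m) v'"
    and "\<And>u v m. \<lbrakk>u \<in> V; v \<in> V\<rbrakk> \<Longrightarrow> g (graph_dist E u v) m = pmf (\<mu> u m) v"
    and "X \<in> V" and "Y \<in> V" and "graph_dist E X Y = d"
    and "\<delta> = nat \<lfloor>real d / 2\<rfloor>" and "\<delta>' = nat \<lceil>real d / 2\<rceil>"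
  shows "W1 E (\<mu> X n) (\<mu> Y n) =
      (2 * real q + 2 - 2 * real q powi (1 - int \<delta>') - 2 * real q powi (- int \<delta>))
        * fps_nth (eval_x (gen_G1 g) (real q)) n
    + (real d + real d / real q - 4 / (real q - 1)
        + 2 * real \<delta>' * real q powi (- int \<delta>') + 2 / (real q - 1) * real q powi (- int \<delta>')
        + 2 * real \<delta> * real q powi (- 1 - int \<delta>) + 2 / (real q - 1) * real q powi (- int \<delta>))
        * fps_nth (eval_x (gen_G g) (real q)) n
    - real d / real q * fps_nth (gen_gamma g 0) n
    + (\<Sum>i=0..\<delta>.
        (4 / (real q - 1)
         + (2 * real i - 2 * real \<delta>' - 2 / (real q - 1)) * real q powi (int i - int \<delta>')
         + (2 * real i / real q - 2 * real \<delta> / real q - 2 / (real q - 1))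
             * real q powi (int i - int \<delta>))
        * fps_nth (gen_gamma g i) n)"
proof -
  interpret regular_tree_graph V E q
    by (rule regular_tree_graphI) (use assms(1,3) in simp_all)
  \<comment> \<open>\<open>L\<close> bounds the support and exceeds \<open>\<delta>\<close>, so that
    sums over \<open>l < L\<close> contain all correction terms.\<close>
  obtain L where L: "\<And>l. l \<ge> L \<Longrightarrow> g l n = 0" "L > \<delta>"
  proof -
    let ?S = "insert \<delta> (dist X ` set_pmf (\<mu> X n))"
    have "finite ?S" using assms(4,7) by simp
    then have M: "k \<le> Max ?S" if "k \<in> ?S" for k using that by (rule Max_ge)
    have "g l n = 0" if "l \<ge> Suc (Max ?S)" for l
    proof -
      obtain v where v: "v \<in> V" "dist X v = l"
        using sphere_nonempty[OF \<open>X \<in> V\<close>, of l] by (auto simp: sphere_def)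
      then have "v \<notin> set_pmf (\<mu> X n)" using M[of l] that by (meson image_eqI insertI2 not_less_eq_eq)
      then show ?thesis using assms(6)[of X v n] v \<open>X \<in> V\<close> by (simp add: pmf_eq_0_set_pmf)
    qed
    moreover have "\<delta> < Suc (Max ?S)" using M[of \<delta>] by (simp only: insertI1 less_Suc_eq_le)
    ultimately show ?thesis using that by blast
  qed
  interpret radial_measures V E q "\<lambda>u. \<mu> u n" "\<lambda>l. g l n" L
    by unfold_locales (use assms(4) assms(6)[symmetric] L(1) in simp_all)
  define Q c1 c2 where "Q = real q"
    and "c1 = 2 * Q + 2 - 2 * Q powi (1 - int \<delta>') - 2 * Q powi (- int \<delta>)"
    and "c2 = real d + real d / Q - 4 / (Q - 1)
        + 2 * real \<delta>' * Q powi (- int \<delta>') + 2 / (Q - 1) * Q powi (- int \<delta>')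
        + 2 * real \<delta> * Q powi (- 1 - int \<delta>) + 2 / (Q - 1) * Q powi (- int \<delta>)"
  define c where "c i = 4 / (Q - 1)
         + (2 * real i - 2 * real \<delta>' - 2 / (Q - 1)) * Q powi (int i - int \<delta>')
         + (2 * real i / Q - 2 * real \<delta> / Q - 2 / (Q - 1)) * Q powi (int i - int \<delta>)" for i
  have Q: "Q > 1" using assms(1) by (simp add: Q_def)
  have coeff: "2 * sphere_sum q d l = c1 * (real l * Q ^ (l - 1)) + c2 * Q ^ l
      - real d / Q * of_bool (l = 0) + of_bool (l \<le> \<delta>) * c l" for l
  proof -
    \<comment> \<open>With this \<open>m\<close>, \<open>\<delta>'\<close> is \<open>Suc m\<close>
      for both parities, while \<open>\<delta>\<close> is \<open>m\<close> or
      \<open>Suc m\<close>.\<close>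
    obtain m where m: "d = 2 * m + 1 \<or> d = 2 * m + 2"
    proof
      show "d = 2 * ((d - 1) div 2) + 1 \<or> d = 2 * ((d - 1) div 2) + 2" using \<open>d \<ge> 1\<close> by presburger
    qed
    have "\<delta> = d div 2" using assms(10) floor_divide_of_nat_eq[where 'a = real, of d 2] by simp
    moreover have "\<lceil>real d / 2\<rceil> = int (Suc m)" by (rule ceiling_unique) (use m in auto)
    then have "\<delta>' = Suc m" using assms(11) by simp
    ultimately consider "d = 2 * m + 1" "\<delta> = m" "\<delta>' = Suc m"
      | "d = 2 * m + 2" "\<delta> = Suc m" "\<delta>' = Suc m"
      using m by fastforce
    then show ?thesis
    proof cases
      case 1
      show ?thesis
        unfolding c1_def c2_def c_def 1 by (rule coefficient_odd[OF Q Q_def])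
    next
      case 2
      show ?thesis
        unfolding c1_def c2_def c_def 2 by (rule coefficient_even[OF Q Q_def])
    qed
  qed
  have "W1 E (\<mu> X n) (\<mu> Y n) = (\<Sum>l<L. g l n * (2 * sphere_sum q d l))"
    using W1_radial[OF assms(7,8)] assms(9) by simp
  also have "\<dots> = (\<Sum>l<L. c1 * (g l n * (real l * Q ^ (l - 1))) + c2 * (g l n * Q ^ l)
      - real d / Q * (g l n * of_bool (l = 0)) + c l * g l n * of_bool (l \<le> \<delta>))"
    unfolding coeff by (intro sum.cong refl) (simp add: algebra_simps)
  also have "\<dots> = c1 * (\<Sum>l<L. g l n * (real l * Q ^ (l - 1))) + c2 * (\<Sum>l<L. g l n * Q ^ l)
      - real d / Q * (\<Sum>l<L. g l n * of_bool (l = 0)) + (\<Sum>l<L. c l * g l n * of_bool (l \<le> \<delta>))"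
    by (simp only: sum.distrib sum_subtractf sum_distrib_left)
  also have "(\<Sum>l<L. g l n * of_bool (l = 0)) = (\<Sum>l\<in>{0}. g l n)"
    using L(2) by (intro sum.mono_neutral_cong_right) auto
  also have "(\<Sum>l<L. c l * g l n * of_bool (l \<le> \<delta>)) = (\<Sum>l=0..\<delta>. c l * g l n)"
    using L(2) by (intro sum.mono_neutral_cong_right) auto
  also have "(\<Sum>l<L. g l n * (real l * Q ^ (l - 1))) = fps_nth (eval_x (gen_G1 g) Q) n"
    by (rule eval_gen_G1[of L g n Q, OF L(1), symmetric])
  also have "(\<Sum>l<L. g l n * Q ^ l) = fps_nth (eval_x (gen_G g) Q) n"
    by (rule eval_gen_G[of L g n Q, OF L(1), symmetric])
  finally show ?thesis
    unfolding c1_def c2_def c_def Q_def by (simp add: gen_gamma_def)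
qed

end
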